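(* Let $\mathsf F:X\to X^\star$ satisfy (F1), (F2), (F3), let the forms $a(u;\cdot,\cdot)$ be uniformly coercive and bounded with constants $\alpha,\beta>0$, and let the error estimators $\eta_N$ satisfy (A1) and (A2) with constants $C_{A1},C_{A2}\ge1$. Suppose there are constants $0<q<1$ and $C_p>0$ such that $$\eta_{N+1}(u_{N+1}^\star)^2\le q\,\eta_N(u_N^\star)^2+C_p\|u_{N+1}^\star-u_N^\star\|_X^2\qquad\text{for all }N\ge0 .$$ Let $\gamma:=\frac{\nu}{2C_p}$, let $\lambda\in(0,C_\lambda^{-1})$ with $C_\lambda:=(1+\beta/\nu)\,C_{A1}$, and set $$q_\Delta:=\frac{L_{\mathsf F}C_{A2}^2+2\gamma q}{L_{\mathsf F}C_{A2}^2+2\gamma},\qquad\text{for which } q<q_\Delta<1 .$$ If, in the adaptive ILG algorithm with parameter $\lambda$, the inner (while) loop terminates after finitely many steps with $\eta_N(u_N)>0$ for all $N\ge0$, then the quantities $$\Delta_N:=\mathsf H(u_N^\star)-\mathsf H(u^\star)+\gamma\,\eta_N(u_N^\star)^2$$ satisfy $$\Delta_{N+1}\le q_\Delta\,\Delta_N\qquad\text{for all }N\ge0 .$$ Moreover, there is a constant $C>0$ such that $$\eta_{N+K}(u_{N+K})^2\le C\,q_\Delta^K\,\eta_N(u_N)^2\qquad\text{for all }N,K\ge0 .$$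
   Context: $X$ is a real Hilbert space with norm $\|\cdot\|_X$, dual $X^\star$ and duality pairing $\langle\cdot,\cdot\rangle$ on $X^\star\times X$. Conditions on $\mathsf F:X\to X^\star$: (F1) there is $L_{\mathsf F}>0$ with $|\langle \mathsf F(u)-\mathsf F(v),w\rangle|\le L_{\mathsf F}\|u-v\|_X\|w\|_X$ for all $u,v,w\in X$; (F2) there is $\nu>0$ with $\nu\|u-v\|_X^2\le\langle \mathsf F(u)-\mathsf F(v),u-v\rangle$ for all $u,v\in X$; (F3) there is a Gâteaux differentiable functional $\mathsf H:X\to\mathbb R$ with $\mathsf H'=\mathsf F$. Under (F1)–(F2), $\mathsf F(u)=0$ has a unique solution $u^\star\in X$. For each $v\in X$, $\mathsf A[v]:X\to X^\star$ is a given linear invertible operator; $a(u;v,w):=\langle \mathsf A[u]v,w\rangle$ and $f(u):=\mathsf A[u]u-\mathsf F(u)\in X^\star$. Uniform coercivity and boundedness mean: there are $\alpha,\beta>0$, independent of $u\in X$, with $a(u;v,v)\ge\alpha\|v\|_X^2$ and $a(u;v,w)\le\beta\|v\|_X\|w\|_X$ for all $u,v,w\in X$. $X_0\subset X_1\subset X_2\subset\cdots\subset X$ are finite dimensional subspaces. $u_N^\star\in X_N$ is the unique solution of $\langle \mathsf F(u_N^\star),v\rangle=0$ for all $v\in X_N$. For each $N\ge0$, $\eta_N:X_N\to[0,\infty)$ is a function (error estimator). With constants $C_{A1},C_{A2}\ge1$ independent of $N$: (A1) $|\eta_N(u)-\eta_N(v)|\le C_{A1}\|u-v\|_X$ for all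 $u,v\in X_N$; (A2) $\|u^\star-u_N^\star\|_X\le C_{A2}\,\eta_N(u_N^\star)$. Adaptive ILG algorithm with parameter $\lambda>0$: start with $X_0$ and an arbitrary $u_0^0\in X_0$. For $N=0,1,2,\dots$: starting from $u_N^0\in X_N$, compute for $n=0,1,2,\dots$ the solution $u_N^{n+1}\in X_N$ of $a(u_N^n;u_N^{n+1},v)=\langle f(u_N^n),v\rangle$ for all $v\in X_N$, and stop this inner (while) loop at the first index $n\ge1$ for which $\|u_N^n-u_N^{n-1}\|_X\le\lambda\,\eta_N(u_N^n)$; set $u_N:=u_N^n$ for this index, enrich $X_N$ to $X_{N+1}\supset X_N$ (based on $\eta_N(u_N)$), and set $u_{N+1}^0:=u_N$. The outer loop is run for all $N\ge0$. *)

theory Defs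
  imports "HOL-Analysis.Analysis"
begin

text \<open>
  The dual of a real Hilbert space \<open>'a\<close> is the Banach space \<open>'a \<Rightarrow>\<^sub>L real\<close> of bounded
  linear functionals, and the duality pairing of \<open>\<phi>\<close> and \<open>v\<close> is \<open>blinfun_apply \<phi> v\<close>.
\<close>

definition has_gateaux_derivative ::
    "('a::real_normed_vector \<Rightarrow> real) \<Rightarrow> ('a \<Rightarrow>\<^sub>L real) \<Rightarrow> 'a \<Rightarrow> bool" where
  "has_gateaux_derivative H \<phi> u \<longleftrightarrow>
     (\<forall>v. ((\<lambda>t::real. (H (u + t *\<^sub>R v) - H u) / t) \<longlongrightarrow> blinfun_apply \<phi> v) (at 0))"

definition finite_dim_subspace :: "'a::real_vector set \<Rightarrow> bool" where
  "finite_dim_subspace S \<longleftrightarrow> subspace S \<and> (\<exists>B. finite B \<and> span B = S)"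

definition galerkin_solution ::
    "('a::real_normed_vector \<Rightarrow> 'a \<Rightarrow>\<^sub>L real) \<Rightarrow> 'a set \<Rightarrow> 'a \<Rightarrow> bool" where
  "galerkin_solution F S u \<longleftrightarrow> u \<in> S \<and> (\<forall>v\<in>S. blinfun_apply (F u) v = 0)"

definition ilg_form ::
    "('a::real_normed_vector \<Rightarrow> 'a \<Rightarrow> 'a \<Rightarrow>\<^sub>L real) \<Rightarrow> 'a \<Rightarrow> 'a \<Rightarrow> 'a \<Rightarrow> real" where
  "ilg_form A u v w = blinfun_apply (A u v) w"

definition ilg_rhs ::
    "('a::real_normed_vector \<Rightarrow> 'a \<Rightarrow> 'a \<Rightarrow>\<^sub>L real) \<Rightarrow> ('a \<Rightarrow> 'a \<Rightarrow>\<^sub>L real) \<Rightarrow> 'a \<Rightarrow> 'a \<Rightarrow>\<^sub>L real" where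
  "ilg_rhs A F u = A u u - F u"

definition ilg_step ::
    "('a::real_normed_vector \<Rightarrow> 'a \<Rightarrow> 'a \<Rightarrow>\<^sub>L real) \<Rightarrow> ('a \<Rightarrow> 'a \<Rightarrow>\<^sub>L real) \<Rightarrow>
      'a set \<Rightarrow> 'a \<Rightarrow> 'a \<Rightarrow> bool" where
  "ilg_step A F S u u' \<longleftrightarrow>
     u' \<in> S \<and> (\<forall>v\<in>S. ilg_form A u u' v = blinfun_apply (ilg_rhs A F u) v)"

text \<open>
  In the following, \<open>w n\<close> is the \<open>n\<close>-th iterate of one inner loop and \<open>\<eta>\<close> the error
  estimator on the current space.
\<close>

definition inner_stop ::
    "real \<Rightarrow> ('a::real_normed_vector \<Rightarrow> real) \<Rightarrow> (nat \<Rightarrow> 'a) \<Rightarrow> nat \<Rightarrow> bool" where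
  "inner_stop lam \<eta> w n \<longleftrightarrow> n \<ge> 1 \<and> norm (w n - w (n - 1)) \<le> lam * \<eta> (w n)"

definition inner_terminates ::
    "real \<Rightarrow> ('a::real_normed_vector \<Rightarrow> real) \<Rightarrow> (nat \<Rightarrow> 'a) \<Rightarrow> bool" where
  "inner_terminates lam \<eta> w \<longleftrightarrow> (\<exists>n. inner_stop lam \<eta> w n)"

text \<open>Only meaningful if the inner loop terminates.\<close>

definition inner_result ::
    "real \<Rightarrow> ('a::real_normed_vector \<Rightarrow> real) \<Rightarrow> (nat \<Rightarrow> 'a) \<Rightarrow> 'a" where
  "inner_result lam \<eta> w = w (LEAST n. inner_stop lam \<eta> w n)"

text \<open>
  \<open>u N n\<close> is the \<open>n\<close>-th inner iterate on the space \<open>X N\<close>. Its values are constrained only as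
  long as the inner loop is running; after the stopping index they are irrelevant.
  The space \<open>X (Suc N)\<close> may have been chosen in dependence on the result on \<open>X N\<close>:
  the predicate describes a run of the algorithm together with the spaces it has produced.
\<close>

definition adaptive_ilg_run ::
    "('a::real_normed_vector \<Rightarrow> 'a \<Rightarrow> 'a \<Rightarrow>\<^sub>L real) \<Rightarrow> ('a \<Rightarrow> 'a \<Rightarrow>\<^sub>L real) \<Rightarrow>
      (nat \<Rightarrow> 'a set) \<Rightarrow> (nat \<Rightarrow> 'a \<Rightarrow> real) \<Rightarrow> real \<Rightarrow> (nat \<Rightarrow> nat \<Rightarrow> 'a) \<Rightarrow> bool" where
  "adaptive_ilg_run A F X \<eta> lam u \<longleftrightarrow>
     u 0 0 \<in> X 0 \<and>
     (\<forall>N n. (\<forall>k\<le>n. \<not> inner_stop lam (\<eta> N) (u N) k) \<longrightarrow> ilg_step A F (X N) (u N n) (u N (Suc n))) \<and>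
     (\<forall>N. inner_terminates lam (\<eta> N) (u N) \<longrightarrow> u (Suc N) 0 = inner_result lam (\<eta> N) (u N))"

end

theory Submission
  imports Defs
begin

text \<open>
  On a line through a Galerkin solution the derivative of the energy \<open>H\<close> is pinched between two
  linear functions, so energy differences are equivalent to squared distances. Hence the energy
  drop from one space to the next absorbs the perturbation term of the estimator reduction, and
  reliability bounds the energy error by the estimator; together this contracts \<open>\<Delta>\<close>.
  The stopping criterion makes the estimators at the computed and at the exact discrete solution
  comparable, which transfers the decay of \<open>\<Delta>\<close> to the computed iterates.
\<close>

section \<open>Energy differences along line segments\<close>

lemma gateaux_imp_line_derivative:
  assumes "has_gateaux_derivative H \<phi> (u + t *\<^sub>R d)"
  shows "((\<lambda>s. H (u + s *\<^sub>R d)) has_real_derivative blinfun_apply \<phi> d) (at t)"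
proof -
  have "((\<lambda>h. (H (u + t *\<^sub>R d + h *\<^sub>R d) - H (u + t *\<^sub>R d)) / h) \<longlongrightarrow> blinfun_apply \<phi> d) (at 0)"
    using assms unfolding has_gateaux_derivative_def by blast
  then show ?thesis
    by (simp add: DERIV_def scaleR_add_left add.assoc)
qed

text \<open>Since \<open>F u\<close> vanishes in the direction \<open>v - u\<close>, it may be
  subtracted from the derivative along the segment. Monotonicity and the Lipschitz bound then pinch
  that derivative between \<open>\<nu> * t * (norm d)\<^sup>2\<close> and
  \<open>L * t * (norm d)\<^sup>2\<close>; integration over [0,1] yields the factors 1/2.
  Orthogonality in this single direction covers both \<open>ustar\<close> and Galerkin
  solutions.\<close>

lemma energy_equivalence:
  fixes F :: "'a::real_normed_vector \<Rightarrow> 'a \<Rightarrow>\<^sub>L real"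
  assumes lipschitz: "\<And>u v w. \<bar>blinfun_apply (F u - F v) w\<bar> \<le> L * norm (u - v) * norm w"
    and monotone: "\<And>u v. \<nu> * (norm (u - v))\<^sup>2 \<le> blinfun_apply (F u - F v) (u - v)"
    and gateaux: "\<And>u. has_gateaux_derivative H (F u) u"
    and orthogonal: "blinfun_apply (F u) (v - u) = 0"
  shows "\<nu> / 2 * (norm (v - u))\<^sup>2 \<le> H v - H u"
    and "H v - H u \<le> L / 2 * (norm (v - u))\<^sup>2"
proof -
  define d where "d = v - u"
  define \<phi> where "\<phi> t = H (u + t *\<^sub>R d)" for t
  have deriv: "(\<phi> has_real_derivative blinfun_apply (F (u + t *\<^sub>R d)) d) (at t)" for t
    unfolding \<phi>_def by (rule gateaux_imp_line_derivative[OF gateaux])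
  have shift: "blinfun_apply (F (u + t *\<^sub>R d)) d = blinfun_apply (F (u + t *\<^sub>R d) - F u) d" for t
    using orthogonal by (simp add: d_def blinfun.diff_left)
  have lower: "\<nu> * t * (norm d)\<^sup>2 \<le> blinfun_apply (F (u + t *\<^sub>R d)) d" if "0 \<le> t" for t
  proof (cases "t = 0")
    case True
    then show ?thesis using orthogonal by (simp add: d_def)
  next
    case False
    with that have "t > 0" by simp
    \<comment> \<open>Monotonicity is tested with the increment \<open>t *\<^sub>R d\<close>, so
      both sides carry a surplus factor \<open>t\<close>, cancelled at the end; hence the separate
      case \<open>t = 0\<close>.\<close>
    have "t * (\<nu> * t * (norm d)\<^sup>2) = \<nu> * (norm (u + t *\<^sub>R d - u))\<^sup>2"
      by (simp add: power_mult_distrib power2_eq_square)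
    also have "\<dots> \<le> blinfun_apply (F (u + t *\<^sub>R d) - F u) (u + t *\<^sub>R d - u)"
      by (rule monotone)
    also have "\<dots> = t * blinfun_apply (F (u + t *\<^sub>R d)) d"
      using shift[of t] by (simp add: blinfun.scaleR_right)
    finally show ?thesis using \<open>t > 0\<close> by simp
  qed
  have upper: "blinfun_apply (F (u + t *\<^sub>R d)) d \<le> L * t * (norm d)\<^sup>2" if "0 \<le> t" for t
  proof -
    have "blinfun_apply (F (u + t *\<^sub>R d)) d \<le> L * norm (u + t *\<^sub>R d - u) * norm d"
      using lipschitz[of "u + t *\<^sub>R d" u d] shift[of t] by linarith
    also have "\<dots> = L * t * (norm d)\<^sup>2"
      using that by (simp add: power2_eq_square)
    finally show ?thesis .
  qed
  have parabola: "((\<lambda>s. c / 2 * s\<^sup>2 * (norm d)\<^sup>2) has_real_derivative c * t * (norm d)\<^sup>2) (at t)"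
    for c t :: real
    by (auto intro!: derivative_eq_intros)
  \<comment> \<open>The energy on the segment minus its lower parabola has nonnegative derivative on
    [0,1]. The squares of 0 and 1 stay unsimplified so that both sides are visibly values of one
    function.\<close>
  have "\<phi> 0 - \<nu> / 2 * 0\<^sup>2 * (norm d)\<^sup>2 \<le> \<phi> 1 - \<nu> / 2 * 1\<^sup>2 * (norm d)\<^sup>2"
    by (rule DERIV_nonneg_imp_nondecreasing)
      (use lower DERIV_diff[OF deriv parabola] in \<open>auto intro!: exI\<close>)
  then show "\<nu> / 2 * (norm (v - u))\<^sup>2 \<le> H v - H u"
    by (simp add: \<phi>_def d_def)
  have "L / 2 * 0\<^sup>2 * (norm d)\<^sup>2 - \<phi> 0 \<le> L / 2 * 1\<^sup>2 * (norm d)\<^sup>2 - \<phi> 1"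
    by (rule DERIV_nonneg_imp_nondecreasing)
      (use upper DERIV_diff[OF parabola deriv] in \<open>auto intro!: exI\<close>)
  then show "H v - H u \<le> L / 2 * (norm (v - u))\<^sup>2"
    by (simp add: \<phi>_def d_def)
qed

lemma galerkin_solution_orthogonal:
  assumes "subspace S" "galerkin_solution F S u" "v \<in> S"
  shows "blinfun_apply (F u) (v - u) = 0"
  using assms unfolding galerkin_solution_def by (simp add: subspace_diff)

section \<open>Error of a single linearized Galerkin step\<close>

text \<open>On \<open>S\<close> the step equation says that \<open>A w (w' - w)\<close> equals
  \<open>- F w\<close>, while \<open>F z\<close> vanishes there. Testing monotonicity with
  \<open>z - w\<close> therefore bounds \<open>norm (z - w)\<close> by \<beta> / \<nu> times the
  increment; the triangle inequality adds the 1.\<close>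

lemma ilg_step_error:
  assumes monotone: "\<And>u v. \<nu> * (norm (u - v))\<^sup>2 \<le> blinfun_apply (F u - F v) (u - v)"
    and "\<nu> > 0"
    and linear: "linear (A w)"
    and bounded: "\<And>x y. ilg_form A w x y \<le> \<beta> * norm x * norm y"
    and "\<beta> \<ge> 0"
    and "subspace S"
    and galerkin: "galerkin_solution F S z"
    and "w \<in> S"
    and step: "ilg_step A F S w w'"
  shows "norm (z - w') \<le> (1 + \<beta> / \<nu>) * norm (w' - w)"
proof -
  have mem: "z - w \<in> S"
    using assms by (simp add: galerkin_solution_def subspace_diff)
  have "\<nu> * (norm (z - w))\<^sup>2 \<le> blinfun_apply (F z - F w) (z - w)"
    by (rule monotone)
  also have "\<dots> = ilg_form A w (w' - w) (z - w)"
    using galerkin step mem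
    by (simp add: galerkin_solution_def ilg_step_def ilg_form_def ilg_rhs_def
        linear_diff[OF linear] blinfun.diff_left)
  also have "\<dots> \<le> \<beta> * norm (w' - w) * norm (z - w)"
    by (rule bounded)
  finally have *: "norm (z - w) * (\<nu> * norm (z - w)) \<le> norm (z - w) * (\<beta> * norm (w' - w))"
    by (simp add: power2_eq_square mult_ac)
  have "\<nu> * norm (z - w) \<le> \<beta> * norm (w' - w)"
    using * \<open>\<beta> \<ge> 0\<close> by (cases "z = w") auto
  then have "norm (z - w) \<le> \<beta> / \<nu> * norm (w' - w)"
    using \<open>\<nu> > 0\<close> by (simp add: field_simps)
  moreover have "norm (z - w') \<le> norm (z - w) + norm (w' - w)"
    using norm_triangle_ineq4[of "z - w" "w' - w"] by simp
  ultimately show ?thesis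
    by (simp add: algebra_simps)
qed

section \<open>Iterates produced by a run of the algorithm\<close>

text \<open>The stopping test demands an index of at least 1, so the stopping index is a successor.
  By its minimality the test fails at all earlier indices, which forces the run to have made these
  steps.\<close>

lemma adaptive_ilg_run_iterates:
  assumes run: "adaptive_ilg_run A F X \<eta> lam u"
    and terminates: "inner_terminates lam (\<eta> N) (u N)"
  obtains m where "inner_result lam (\<eta> N) (u N) = u N (Suc m)"
    and "inner_stop lam (\<eta> N) (u N) (Suc m)"
    and "\<And>k. k \<le> m \<Longrightarrow> ilg_step A F (X N) (u N k) (u N (Suc k))"
proof -
  define n where "n = (LEAST n. inner_stop lam (\<eta> N) (u N) n)"
  have stop: "inner_stop lam (\<eta> N) (u N) n"
    using terminates unfolding inner_terminates_def n_def by (rule LeastI_ex)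
  then obtain m where m: "n = Suc m"
    unfolding inner_stop_def by (cases n) auto
  have "\<not> inner_stop lam (\<eta> N) (u N) k" if "k \<le> m" for k
    using that m not_less_Least[of k "inner_stop lam (\<eta> N) (u N)"] by (simp add: n_def)
  then have "ilg_step A F (X N) (u N k) (u N (Suc k))" if "k \<le> m" for k
    using run that by (simp add: adaptive_ilg_run_def)
  then show ?thesis
    using that stop m by (simp add: inner_result_def n_def)
qed

text \<open>No induction on \<open>N\<close> is involved: a step lands in its space whatever its
  starting value, so the preceding loop ends in \<open>X M\<close>, and nestedness does the
  rest.\<close>

lemma adaptive_ilg_run_start:
  assumes run: "adaptive_ilg_run A F X \<eta> lam u"
    and terminates: "\<And>N. inner_terminates lam (\<eta> N) (u N)"
    and nested: "\<And>N. X N \<subseteq> X (Suc N)"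
  shows "u N 0 \<in> X N"
proof (cases N)
  case 0
  then show ?thesis using run by (simp add: adaptive_ilg_run_def)
next
  case (Suc M)
  obtain m where "inner_result lam (\<eta> M) (u M) = u M (Suc m)"
      "\<And>k. k \<le> m \<Longrightarrow> ilg_step A F (X M) (u M k) (u M (Suc k))"
    using adaptive_ilg_run_iterates[OF run terminates] by metis
  then have "inner_result lam (\<eta> M) (u M) \<in> X M"
    by (auto simp: ilg_step_def)
  moreover have "u (Suc M) 0 = inner_result lam (\<eta> M) (u M)"
    using run terminates by (simp add: adaptive_ilg_run_def)
  ultimately show ?thesis using Suc nested by auto
qed

text \<open>The witness \<open>w\<close> is the penultimate iterate, which lies in
  \<open>X N\<close> as the start of the loop or as the outcome of an earlier step.\<close>

lemma adaptive_ilg_run_last_step: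
  assumes run: "adaptive_ilg_run A F X \<eta> lam u"
    and terminates: "\<And>N. inner_terminates lam (\<eta> N) (u N)"
    and nested: "\<And>N. X N \<subseteq> X (Suc N)"
  obtains w where "w \<in> X N" "ilg_step A F (X N) w (inner_result lam (\<eta> N) (u N))"
    "norm (inner_result lam (\<eta> N) (u N) - w) \<le> lam * \<eta> N (inner_result lam (\<eta> N) (u N))"
proof -
  obtain m where result: "inner_result lam (\<eta> N) (u N) = u N (Suc m)"
    and stop: "inner_stop lam (\<eta> N) (u N) (Suc m)"
    and step: "\<And>k. k \<le> m \<Longrightarrow> ilg_step A F (X N) (u N k) (u N (Suc k))"
    using adaptive_ilg_run_iterates[OF run terminates] by metis
  have "u N m \<in> X N"
  proof (cases m)
    case 0
    then show ?thesis using adaptive_ilg_run_start[OF assms] by simp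
  next
    case (Suc k)
    then show ?thesis using step[of k] by (simp add: ilg_step_def)
  qed
  then show ?thesis
    using that[of "u N m"] step[of m] stop result by (simp add: inner_stop_def)
qed

theorem theorem3p6:
  fixes F :: "'a::{real_inner, complete_space} \<Rightarrow> 'a \<Rightarrow>\<^sub>L real"
    and H :: "'a \<Rightarrow> real"
    and A :: "'a \<Rightarrow> 'a \<Rightarrow> 'a \<Rightarrow>\<^sub>L real"
    and X :: "nat \<Rightarrow> 'a set"
    and \<eta> :: "nat \<Rightarrow> 'a \<Rightarrow> real"
    and ustar :: 'a
    and uNstar :: "nat \<Rightarrow> 'a"
    and u :: "nat \<Rightarrow> nat \<Rightarrow> 'a"
    and uN :: "nat \<Rightarrow> 'a"
    and \<Delta> :: "nat \<Rightarrow> real"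
    and L \<nu> \<alpha> \<beta> CA1 CA2 q Cp \<gamma> lam Clam q\<Delta> :: real
  assumes F1: "L > 0"
      "\<And>u v w. \<bar>blinfun_apply (F u - F v) w\<bar> \<le> L * norm (u - v) * norm w"
    and F2: "\<nu> > 0"
      "\<And>u v. \<nu> * (norm (u - v))\<^sup>2 \<le> blinfun_apply (F u - F v) (u - v)"
    and F3: "\<And>u. has_gateaux_derivative H (F u) u"
    and ustar: "F ustar = 0"
    and A_linear: "\<And>v. linear (A v)"
    and A_invertible: "\<And>v. bij (A v)"
    and coercive: "\<alpha> > 0" "\<And>u v. ilg_form A u v v \<ge> \<alpha> * (norm v)\<^sup>2"
    and bounded: "\<beta> > 0" "\<And>u v w. ilg_form A u v w \<le> \<beta> * norm v * norm w"
    and X_fin_dim: "\<And>N. finite_dim_subspace (X N)"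
    and X_nested: "\<And>N. X N \<subseteq> X (Suc N)"
    and uNstar: "\<And>N. galerkin_solution F (X N) (uNstar N)"
    and eta_nonneg: "\<And>N v. v \<in> X N \<Longrightarrow> \<eta> N v \<ge> 0"
    and A1: "CA1 \<ge> 1"
      "\<And>N v w. v \<in> X N \<Longrightarrow> w \<in> X N \<Longrightarrow> \<bar>\<eta> N v - \<eta> N w\<bar> \<le> CA1 * norm (v - w)"
    and A2: "CA2 \<ge> 1"
      "\<And>N. norm (ustar - uNstar N) \<le> CA2 * \<eta> N (uNstar N)"
    and q: "0 < q" "q < 1"
    and C_p: "Cp > 0"
    and reduction: "\<And>N. (\<eta> (Suc N) (uNstar (Suc N)))\<^sup>2
      \<le> q * (\<eta> N (uNstar N))\<^sup>2 + Cp * (norm (uNstar (Suc N) - uNstar N))\<^sup>2"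
    and gamma: "\<gamma> = \<nu> / (2 * Cp)"
    and C_lambda: "Clam = (1 + \<beta> / \<nu>) * CA1"
    and lam: "0 < lam" "lam < inverse Clam"
    and q_Delta: "q\<Delta> = (L * CA2\<^sup>2 + 2 * \<gamma> * q) / (L * CA2\<^sup>2 + 2 * \<gamma>)"
    and run: "adaptive_ilg_run A F X \<eta> lam u"
    and terminates: "\<And>N. inner_terminates lam (\<eta> N) (u N)"
    and uN: "\<And>N. uN N = inner_result lam (\<eta> N) (u N)"
    and eta_pos: "\<And>N. \<eta> N (uN N) > 0"
    and Delta: "\<And>N. \<Delta> N = H (uNstar N) - H ustar + \<gamma> * (\<eta> N (uNstar N))\<^sup>2"
  shows "q < q\<Delta> \<and> q\<Delta> < 1 \<and>
    (\<forall>N. \<Delta> (Suc N) \<le> q\<Delta> * \<Delta> N) \<and>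
    (\<exists>C>0. \<forall>N K. (\<eta> (N + K) (uN (N + K)))\<^sup>2 \<le> C * q\<Delta> ^ K * (\<eta> N (uN N))\<^sup>2)"
proof -
  have sub: "subspace (X N)" for N
    using X_fin_dim by (simp add: finite_dim_subspace_def)
  have mem: "uNstar N \<in> X N" for N
    using uNstar by (simp add: galerkin_solution_def)
  have gamma_pos: "\<gamma> > 0" using gamma F2(1) C_p by simp
  define e where "e N = H (uNstar N) - H ustar" for N
  define s where "s N = (\<eta> N (uNstar N))\<^sup>2" for N
  have \<Delta>_eq: "\<Delta> N = e N + \<gamma> * s N" for N
    by (simp add: Delta e_def s_def)

  \<comment> \<open>Energy bounds and the one-level estimate\<close>
  have ustar_orth: "blinfun_apply (F ustar) (v - ustar) = 0" for v
    by (simp add: ustar)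
  have e_nonneg: "e N \<ge> 0" for N
    using energy_equivalence(1)[OF F1(2) F2(2) F3 ustar_orth, of "uNstar N"] F2(1)
    unfolding e_def by (smt (verit) divide_nonneg_nonneg mult_nonneg_nonneg zero_le_power2)
  have e_le: "2 * e N \<le> L * CA2\<^sup>2 * s N" for N
  proof -
    have "2 * e N \<le> L * (norm (uNstar N - ustar))\<^sup>2"
      using energy_equivalence(2)[OF F1(2) F2(2) F3 ustar_orth, of "uNstar N"]
      by (simp add: e_def)
    also have "\<dots> \<le> L * (CA2 * \<eta> N (uNstar N))\<^sup>2"
      using A2(2)[of N] F1(1) by (intro mult_left_mono power_mono) (auto simp: norm_minus_commute)
    finally show ?thesis by (simp add: s_def power_mult_distrib)
  qed
  \<comment> \<open>By nestedness \<open>uNstar N\<close> is a competitor in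
    \<open>X (Suc N)\<close>, so the lower energy bound applies at the Galerkin solution
    \<open>uNstar (Suc N)\<close>.\<close>
  have e_Suc: "e (Suc N) + \<nu> / 2 * (norm (uNstar (Suc N) - uNstar N))\<^sup>2 \<le> e N" for N
  proof -
    have "uNstar N \<in> X (Suc N)" using mem X_nested by blast
    from energy_equivalence(1)[OF F1(2) F2(2) F3
        galerkin_solution_orthogonal[OF sub uNstar this]]
    show ?thesis by (simp add: e_def norm_minus_commute)
  qed
  \<comment> \<open>The choice of \<gamma> makes \<open>\<gamma> * Cp\<close> equal to \<nu> / 2, so
    the energy drop pays exactly for the perturbation in \<open>reduction\<close>.\<close>
  have \<Delta>_Suc: "\<Delta> (Suc N) \<le> e N + \<gamma> * q * s N" for N
  proof -
    have "\<gamma> * s (Suc N) \<le> \<gamma> * (q * s N + Cp * (norm (uNstar (Suc N) - uNstar N))\<^sup>2)"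
      using reduction[of N] gamma_pos by (simp add: s_def)
    also have "\<dots> = \<gamma> * q * s N + \<nu> / 2 * (norm (uNstar (Suc N) - uNstar N))\<^sup>2"
      using C_p by (simp add: gamma field_simps)
    finally show ?thesis using e_Suc[of N] by (simp add: \<Delta>_eq)
  qed

  \<comment> \<open>Contraction factor and decay of \<Delta>\<close>
  define D where "D = L * CA2\<^sup>2 + 2 * \<gamma>"
  have LC_pos: "L * CA2\<^sup>2 > 0" using F1(1) A2(1) by simp
  then have D_pos: "D > 0" using gamma_pos by (simp add: D_def)
  have one_minus: "1 - q\<Delta> = 2 * \<gamma> * (1 - q) / D"
    using D_pos unfolding q_Delta D_def[symmetric] by (simp add: field_simps) (simp add: D_def)
  have minus_q: "q\<Delta> - q = L * CA2\<^sup>2 * (1 - q) / D"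
    using D_pos unfolding q_Delta D_def[symmetric]
    by (simp add: field_simps) (simp add: D_def algebra_simps)
  have "1 - q\<Delta> > 0" unfolding one_minus using gamma_pos q D_pos by simp
  then have q\<Delta>_less: "q\<Delta> < 1" by simp
  have "q\<Delta> - q > 0" unfolding minus_q using LC_pos q D_pos by simp
  then have q_less: "q < q\<Delta>" by simp

  \<comment> \<open>\<open>q\<Delta>\<close> balances the two parts of \<Delta>:
    \<open>(1 - q\<Delta>) * L * CA2\<^sup>2\<close> equals
    \<open>2 * \<gamma> * (q\<Delta> - q)\<close>, so by \<open>e_le\<close> the surplus of energy
    is absorbed by the slack in the estimator term.\<close>
  have contraction: "\<Delta> (Suc N) \<le> q\<Delta> * \<Delta> N" for N
  proof -
    have "(1 - q\<Delta>) * e N = \<gamma> * (1 - q) / D * (2 * e N)"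
      by (simp add: one_minus)
    also have "\<dots> \<le> \<gamma> * (1 - q) / D * (L * CA2\<^sup>2 * s N)"
      using gamma_pos q D_pos by (intro mult_left_mono e_le) simp
    also have "\<dots> = \<gamma> * (q\<Delta> - q) * s N"
      by (simp add: minus_q)
    finally show ?thesis
      using \<Delta>_Suc[of N] by (simp add: \<Delta>_eq algebra_simps)
  qed
  have decay: "\<Delta> (N + K) \<le> q\<Delta> ^ K * \<Delta> N" for N K
  proof (induction K)
    case (Suc K)
    have "\<Delta> (N + Suc K) \<le> q\<Delta> * \<Delta> (N + K)" using contraction by simp
    also have "\<dots> \<le> q\<Delta> * (q\<Delta> ^ K * \<Delta> N)"
      using Suc q q_less by (intro mult_left_mono) auto
    finally show ?case by (simp add: mult_ac)
  qed simp

  \<comment> \<open>Comparison of estimators at computed and exact discrete solutions\<close>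
  define \<theta> where "\<theta> = lam * Clam"
  have Clam_pos: "Clam > 0"
    using C_lambda A1(1) bounded(1) F2(1) by (simp add: add_pos_pos)
  \<comment> \<open>The bound on \<open>lam\<close> is precisely \<theta> < 1, which keeps
    \<open>1 - \<theta>\<close> positive in the lower comparison of estimators.\<close>
  have \<theta>: "0 < \<theta>" "\<theta> < 1"
    using lam Clam_pos by (simp_all add: \<theta>_def field_simps)
  have close: "\<bar>\<eta> N (uNstar N) - \<eta> N (uN N)\<bar> \<le> \<theta> * \<eta> N (uN N)" for N
  proof -
    obtain w where w: "w \<in> X N" "ilg_step A F (X N) w (uN N)"
        "norm (uN N - w) \<le> lam * \<eta> N (uN N)"
      using adaptive_ilg_run_last_step[OF run terminates X_nested, of N] unfolding uN by blast
    have "uN N \<in> X N" using w(2) by (simp add: ilg_step_def)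
    then have "\<bar>\<eta> N (uNstar N) - \<eta> N (uN N)\<bar> \<le> CA1 * norm (uNstar N - uN N)"
      by (intro A1(2) mem)
    also have "\<dots> \<le> CA1 * ((1 + \<beta> / \<nu>) * norm (uN N - w))"
      using A1(1) ilg_step_error[OF F2(2) F2(1) A_linear bounded(2) _ sub uNstar w(1,2)] bounded(1)
      by (intro mult_left_mono) auto
    also have "\<dots> \<le> CA1 * ((1 + \<beta> / \<nu>) * (lam * \<eta> N (uN N)))"
      using A1(1) bounded(1) F2(1) w(3) by (intro mult_left_mono) auto
    finally show ?thesis by (simp add: \<theta>_def C_lambda mult_ac)
  qed
  have upper: "s N \<le> (1 + \<theta>)\<^sup>2 * (\<eta> N (uN N))\<^sup>2" for N
  proof -
    have "\<eta> N (uNstar N) \<le> (1 + \<theta>) * \<eta> N (uN N)"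
      using close[of N] by (simp add: algebra_simps)
    then have "(\<eta> N (uNstar N))\<^sup>2 \<le> ((1 + \<theta>) * \<eta> N (uN N))\<^sup>2"
      using eta_nonneg[OF mem] by (rule power_mono)
    then show ?thesis by (simp add: s_def power_mult_distrib)
  qed
  have lower: "(1 - \<theta>)\<^sup>2 * (\<eta> N (uN N))\<^sup>2 \<le> s N" for N
  proof -
    have "(1 - \<theta>) * \<eta> N (uN N) \<le> \<eta> N (uNstar N)"
      using close[of N] by (simp add: algebra_simps)
    then have "((1 - \<theta>) * \<eta> N (uN N))\<^sup>2 \<le> (\<eta> N (uNstar N))\<^sup>2"
      using \<theta> eta_pos[of N] by (intro power_mono) auto
    then show ?thesis by (simp add: s_def power_mult_distrib)
  qed

  \<comment> \<open>Decay of the computed estimators\<close>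
  define c where "c = \<gamma> * (1 - \<theta>)\<^sup>2"
  \<comment> \<open>\<open>D / 2\<close> comes from \<open>\<Delta> N \<le> D / 2 * s N\<close>, a
    consequence of \<open>e_le\<close>. The factor \<open>(1 + \<theta>)\<^sup>2\<close> passes to
    the computed iterate at level \<open>N\<close>; dividing by \<open>c\<close> does so at level
    \<open>N + K\<close>, where the nonnegative energy part of \<Delta> is dropped.\<close>
  define C where "C = D / 2 * (1 + \<theta>)\<^sup>2 / c"
  have c_pos: "c > 0" using gamma_pos \<theta> by (simp add: c_def)
  have "C > 0" using c_pos D_pos \<theta> by (simp add: C_def)
  moreover have "(\<eta> (N + K) (uN (N + K)))\<^sup>2 \<le> C * q\<Delta> ^ K * (\<eta> N (uN N))\<^sup>2" for N K
  proof -
    have "c * (\<eta> (N + K) (uN (N + K)))\<^sup>2 \<le> \<gamma> * s (N + K)"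
      using lower[of "N + K"] gamma_pos by (simp add: c_def)
    also have "\<dots> \<le> \<Delta> (N + K)"
      using e_nonneg by (simp add: \<Delta>_eq)
    also have "\<dots> \<le> q\<Delta> ^ K * \<Delta> N"
      by (rule decay)
    also have "\<dots> \<le> q\<Delta> ^ K * (D / 2 * s N)"
      using e_le[of N] q q_less by (intro mult_left_mono) (auto simp: \<Delta>_eq D_def algebra_simps)
    also have "\<dots> \<le> q\<Delta> ^ K * (D / 2 * ((1 + \<theta>)\<^sup>2 * (\<eta> N (uN N))\<^sup>2))"
      using q q_less D_pos upper by (intro mult_left_mono) auto
    finally show ?thesis
      using c_pos by (simp add: C_def field_simps)
  qed
  ultimately show ?thesis
    using q_less q\<Delta>_less contraction by blast
qed

end
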